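(* For makespan minimization on two related machines with speed ratio $s>1$, the algorithm $\textsc{Fast}$ has online bounded ratio $\frac{s+1}{s}$.
   Context: There are two machines, one with speed $s$ (the faster machine) and one with speed $1$. Jobs with positive sizes arrive online and each must be assigned irrevocably to one machine; the completion time of a machine is the total size of its jobs divided by its speed, and the makespan is the maximum completion time; the goal is to minimize the makespan. $\textsc{Fast}$ assigns every job to the faster machine. For a deterministic online algorithm $A$ of a minimization problem, $\textsc{Opt}_A$ denotes an offline algorithm that is optimal among offline algorithms whose solution on any input $I$ satisfies, for every prefix $I'$ of $I$, that the cost of the solution restricted to $I'$ is at most $A(I')$. The online bounded ratio of $A$ is the infimum of all constants $c$ such that $A(I) \le c\,\textsc{Opt}_A(I)$ for all inputs $I$. *)

theory Defs
  imports Complex_Main "HOL-Library.Extended_Real"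
begin

text \<open>
  An online minimization problem is given by its set of inputs (request lists) and a cost
  function on an input together with the list of answers, one answer per request.
  A deterministic online algorithm maps the requests revealed so far, the current one being
  the last, to the answer to the current request.
\<close>

type_synonym ('r, 'a) online_algorithm = "'r list \<Rightarrow> 'a"
type_synonym ('r, 'a) cost_function = "'r list \<Rightarrow> 'a list \<Rightarrow> real"

definition run :: "('r, 'a) online_algorithm \<Rightarrow> 'r list \<Rightarrow> 'a list" where
  "run A I = map (\<lambda>i. A (take (Suc i) I)) [0..<length I]"

definition alg_cost :: "('r, 'a) cost_function \<Rightarrow> ('r, 'a) online_algorithm \<Rightarrow> 'r list \<Rightarrow> real" where
  "alg_cost cost A I = cost I (run A I)"

definition online_bounded ::
  "('r, 'a) cost_function \<Rightarrow> ('r, 'a) online_algorithm \<Rightarrow> 'r list \<Rightarrow> 'a list \<Rightarrow> bool" where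
  "online_bounded cost A I ys \<longleftrightarrow>
     length ys = length I \<and>
     (\<forall>n\<le>length I. cost (take n I) (take n ys) \<le> alg_cost cost A (take n I))"

text \<open>The infimum is a minimum for finite answer types; see \<open>opt_bounded_attained\<close> below.\<close>

definition opt_bounded ::
  "('r, 'a) cost_function \<Rightarrow> ('r, 'a) online_algorithm \<Rightarrow> 'r list \<Rightarrow> real" where
  "opt_bounded cost A I = Inf {cost I ys | ys. online_bounded cost A I ys}"

text \<open>Extended real, so that the ratio is \<open>\<infinity>\<close> if there is no suitable constant.\<close>

definition online_bounded_ratio ::
  "'r list set \<Rightarrow> ('r, 'a) cost_function \<Rightarrow> ('r, 'a) online_algorithm \<Rightarrow> ereal" where
  "online_bounded_ratio inputs cost A =
     Inf {ereal c | c. \<forall>I\<in>inputs. alg_cost cost A I \<le> c * opt_bounded cost A I}"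

lemma take_run: "n \<le> length I \<Longrightarrow> take n (run A I) = run A (take n I)"
  by (auto simp: run_def take_map min_def intro!: map_cong)

lemma online_bounded_run: "online_bounded cost A I (run A I)"
  by (simp add: online_bounded_def alg_cost_def take_run) (simp add: run_def)

lemma opt_bounded_attained:
  fixes cost :: "('r, 'a) cost_function"
  assumes "finite (UNIV :: 'a set)"
  obtains ys where "online_bounded cost A I ys" "cost I ys = opt_bounded cost A I"
    "\<And>zs. online_bounded cost A I zs \<Longrightarrow> cost I ys \<le> cost I zs"
proof -
  let ?Y = "{ys. online_bounded cost A I ys}"
  have "?Y \<subseteq> {ys. set ys \<subseteq> UNIV \<and> length ys = length I}"
    by (auto simp: online_bounded_def)
  then have fin: "finite (cost I ` ?Y)"
    using finite_lists_length_eq[OF assms] by (meson finite_imageI finite_subset)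
  have ne: "cost I ` ?Y \<noteq> {}"
    using online_bounded_run by blast
  have eq: "{cost I ys | ys. online_bounded cost A I ys} = cost I ` ?Y"
    by auto
  have Min: "opt_bounded cost A I = Min (cost I ` ?Y)"
    unfolding opt_bounded_def eq by (rule cInf_eq_Min[OF fin ne])
  with Min_in[OF fin ne] obtain ys where
    ys: "online_bounded cost A I ys" "cost I ys = opt_bounded cost A I"
    by auto
  moreover have "cost I ys \<le> cost I zs" if "online_bounded cost A I zs" for zs
    using that fin ys(2) Min by simp
  ultimately show thesis
    using that by blast
qed

datatype machine = Faster | Slower

definition job_inputs :: "real list set" where
  "job_inputs = {I. \<forall>p\<in>set I. 0 < p}"

definition load :: "machine \<Rightarrow> real list \<Rightarrow> machine list \<Rightarrow> real" where
  "load m I ys = (\<Sum>(p, k)\<leftarrow>zip I ys. if k = m then p else 0)"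

fun speed :: "real \<Rightarrow> machine \<Rightarrow> real" where
  "speed s Faster = s"
| "speed s Slower = 1"

definition completion_time :: "real \<Rightarrow> machine \<Rightarrow> real list \<Rightarrow> machine list \<Rightarrow> real" where
  "completion_time s m I ys = load m I ys / speed s m"

definition makespan :: "real \<Rightarrow> (real, machine) cost_function" where
  "makespan s I ys = max (completion_time s Faster I ys) (completion_time s Slower I ys)"

definition fast :: "(real, machine) online_algorithm" where
  "fast I = Faster"

lemma finite_machine: "finite (UNIV :: machine set)"
proof (rule finite_subset)
  show "UNIV \<subseteq> {Faster, Slower}"
    using machine.exhaust by auto
qed simp

end

theory Submission
  imports Defs
begin

text \<open>
  The speeds add up to \<open>s + 1\<close>, so every schedule has makespan at least \<open>1 / (s + 1)\<close> times
  the total size, while \<open>fast\<close> has makespan \<open>1 / s\<close> times the total size. The input \<open>[s, 1]\<close>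
  is tight: scheduling the first job on the faster and the second on the slower machine
  balances the load perfectly and never exceeds the cost of \<open>fast\<close>.
\<close>

lemma load_add_load:
  assumes "length ys = length I"
  shows "load Faster I ys + load Slower I ys = sum_list I"
  using assms[symmetric]
proof (induction I ys rule: list_induct2)
  case (Cons x xs y ys)
  then show ?case
    by (cases y) (simp_all add: load_def)
qed (simp add: load_def)

lemma sum_list_le_makespan:
  assumes "s > 0" "length ys = length I"
  shows "sum_list I \<le> (s + 1) * makespan s I ys"
proof -
  have "load Faster I ys / s \<le> makespan s I ys" "load Slower I ys \<le> makespan s I ys"
    by (simp_all add: makespan_def completion_time_def)
  then show ?thesis
    using assms load_add_load[of ys I] by (simp add: field_simps)
qed

lemma run_fast: "run fast I = replicate (length I) Faster"
  by (simp add: run_def fast_def map_replicate_trivial)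

lemma alg_cost_fast:
  assumes "s > 0" "I \<in> job_inputs"
  shows "alg_cost (makespan s) fast I = sum_list I / s"
proof -
  have "load Slower I (replicate (length I) Faster) = 0"
    by (induction I) (simp_all add: load_def)
  moreover have "load Faster I (replicate (length I) Faster) = sum_list I"
    using load_add_load[of "replicate (length I) Faster" I] calculation by simp
  \<comment> \<open>The slower machine idles at completion time 0, so this sign makes the faster
    machine's time the maximum.\<close>
  moreover have "sum_list I \<ge> 0"
    using assms(2) by (intro sum_list_nonneg) (auto simp: job_inputs_def less_imp_le)
  ultimately show ?thesis
    using assms(1) by (simp add: alg_cost_def run_fast makespan_def completion_time_def)
qed

text \<open>The infimum in \<open>opt_bounded\<close> is attained by an actual schedule, so the
  volume bound \<open>sum_list_le_makespan\<close> carries over to it.\<close>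

lemma alg_cost_fast_le:
  assumes "s > 0" "I \<in> job_inputs"
  shows "alg_cost (makespan s) fast I \<le> (s + 1) / s * opt_bounded (makespan s) fast I"
proof -
  obtain ys where "online_bounded (makespan s) fast I ys"
    "makespan s I ys = opt_bounded (makespan s) fast I"
    using opt_bounded_attained[OF finite_machine] by metis
  then have "sum_list I \<le> (s + 1) * opt_bounded (makespan s) fast I"
    using sum_list_le_makespan[OF assms(1)] by (metis online_bounded_def)
  then show ?thesis
    using assms by (simp add: alg_cost_fast divide_right_mono)
qed

lemma opt_bounded_fast_tight_le:
  assumes "s > 0"
  shows "opt_bounded (makespan s) fast [s, 1] \<le> 1"
proof -
  \<comment> \<open>On the prefix \<open>[s]\<close> both costs are 1; on \<open>[s, 1]\<close> this
    schedule still costs 1, while \<open>fast\<close> costs \<open>(s + 1) / s\<close>.\<close>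
  have "online_bounded (makespan s) fast [s, 1] [Faster, Slower]"
    using assms
    by (auto simp: online_bounded_def alg_cost_def run_fast makespan_def completion_time_def
        load_def le_Suc_eq field_simps)
  moreover have "makespan s [s, 1] [Faster, Slower] = 1"
    using assms by (simp add: makespan_def completion_time_def load_def)
  ultimately show ?thesis
    using opt_bounded_attained[OF finite_machine] by metis
qed

theorem theorem4:
  fixes s :: real
  assumes "s > 1"
  shows "online_bounded_ratio job_inputs (makespan s) fast = ereal ((s + 1) / s)"
proof -
  have s: "s > 0"
    using assms by simp
  have tight: "[s, 1] \<in> job_inputs"
    using s by (simp add: job_inputs_def)
  have "(s + 1) / s \<le> c"
    if c: "\<forall>I\<in>job_inputs. alg_cost (makespan s) fast I \<le> c * opt_bounded (makespan s) fast I"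
    for c
  proof -
    let ?opt = "opt_bounded (makespan s) fast [s, 1]"
    have le: "(s + 1) / s \<le> c * ?opt"
      using bspec[OF c tight] alg_cost_fast[OF s tight] by simp
    \<comment> \<open>The sign of \<open>c\<close> is not known yet, so \<open>?opt \<le> 1\<close>
      alone does not bound \<open>c * ?opt\<close> by \<open>c\<close>. The upper bound, applied to
      the tight input itself, forces \<open>?opt \<ge> 1\<close>.\<close>
    have "(s + 1) / s \<le> (s + 1) / s * ?opt"
      using alg_cost_fast_le[OF s tight] alg_cost_fast[OF s tight] by simp
    moreover have "(s + 1) / s > 0"
      using s by simp
    ultimately have "?opt \<ge> 1"
      by (metis mult_le_cancel_left_pos mult.right_neutral)
    then have "?opt = 1"
      using opt_bounded_fast_tight_le[OF s] by simp
    then show ?thesis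
      using le by simp
  qed
  then show ?thesis
    unfolding online_bounded_ratio_def
    using alg_cost_fast_le[OF s] by (intro antisym Inf_lower Inf_greatest) auto
qed

end
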